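(* Let $r\ge 1$ and $h\ge 1$ be integers, and let $p_1,\dots,p_r>0$ with $p_1+\cdots+p_r=1$. Let $X_1X_2\ldots$ be an infinite random word over the alphabet $\mathcal{A}=\{1,\dots,r\}$ whose letters are i.i.d.\ with $\mathbb{P}\{X_k=i\}=p_i$. For $j\in\{1,\dots,r\}$ let $B_j$ be the smallest $n$ such that there exist $j$ distinct letters each having an $h$-run in $X_1\ldots X_n$. For $i\in\mathcal{A}$ let \[ \alpha_i=\frac{p_i-p_i^h}{1-p_i},\qquad \gamma_i=\frac{p_i}{1-p_i}, \] and let $A_i$ and $\Gamma_i$ be the substitution operators (acting on functions of the variables $v_1,\dots,v_r$) that replace the variable $v_i$ by $\alpha_i$ and by $\gamma_i$, respectively. Let \[ S(v_1,\dots,v_r)=\frac{1}{1-\sum_{i=1}^r\frac{v_i}{1+v_i}}. \] Then \[ \mathbb{E}(B_j)=\biggl(\sum_{q=0}^{j-1}[y^q]\prod_{i=1}^r\bigl(y\Gamma_i+(1-y)A_i\bigr)\biggr)S(v_1,\dots,v_r). \]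
   Context: A letter $\ell$ has an $h$-run in a finite word $w$ if the word $\ell^h$ ($h$ consecutive copies of $\ell$) is a factor of $w$. $S(v_1,\dots,v_r)$ is the multivariate generating function of Smirnov words (words with no two consecutive equal letters) over $\mathcal{A}$, with $v_i$ marking occurrences of letter $i$. The operators $A_i,\Gamma_i$ act on distinct variables and hence commute; the expression $\prod_{i=1}^r(y\Gamma_i+(1-y)A_i)$ is expanded as a polynomial in the formal variable $y$ whose coefficients are linear combinations of compositions of these substitution operators, $[y^q]$ denotes extraction of the coefficient of $y^q$, and the resulting linear combination of operators is applied to $S$ (each composition of substitutions yields $S$ evaluated at the point where each $v_i$ is replaced by $\alpha_i$ or $\gamma_i$).
   Formalization: For r = 1 one has p_1 = 1 and the stated α_1 = (p_1 − p_1^h)/(1 − p_1) is 0/0; there α_1 is taken to be its limit h − 1. For r ≥ 2 the statement is unchanged. *)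

theory Defs
  imports "HOL-Probability.Probability"
    "HOL-Computational_Algebra.Formal_Power_Series"
    "HOL-Library.Sublist"
begin

definition has_run :: "nat \<Rightarrow> 'l \<Rightarrow> 'l list \<Rightarrow> bool" where
  "has_run h l w \<longleftrightarrow> sublist (replicate h l) w"

text \<open>The infinite word \<open>x 1, x 2, \<dots>\<close> is indexed from 1, as is the alphabet \<open>{1..r}\<close>.
  The infimum in \<^typ>\<open>enat\<close> is \<open>\<infinity>\<close> when no such \<open>n\<close> exists.\<close>

definition run_time :: "nat \<Rightarrow> nat \<Rightarrow> nat \<Rightarrow> (nat \<Rightarrow> nat) \<Rightarrow> enat" where
  "run_time r h j x = (INF n \<in> {n. \<exists>L\<subseteq>{1..r}. card L = j \<and>
     (\<forall>l\<in>L. has_run h l (map x [1..<Suc n]))}. enat n)"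

text \<open>The quotient \<open>(p - p ^ h) / (1 - p)\<close> equals \<open>p + p\<^sup>2 + \<dots> + p ^ (h - 1)\<close>. At \<open>p = 1\<close>, which
  happens only for a one-letter alphabet, it is read as this sum, i.e. by continuity.\<close>

definition alpha :: "nat \<Rightarrow> real \<Rightarrow> real" where
  "alpha h p = (if p = 1 then real h - 1 else (p - p ^ h) / (1 - p))"

text \<open>The value at \<open>p = 1\<close> (one-letter alphabet) is meaningless, but it only enters through the
  coefficient of \<open>y\<close> in a product with a single factor, which is never extracted.\<close>

definition gamma :: "real \<Rightarrow> real" where
  "gamma p = p / (1 - p)"

text \<open>Generating function of the words over \<open>{1..r}\<close> without two equal consecutive letters, in
  closed form as a rational function.\<close>

definition smirnov_gf :: "nat \<Rightarrow> (nat \<Rightarrow> real) \<Rightarrow> real" where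
  "smirnov_gf r v = 1 / (1 - (\<Sum>i=1..r. v i / (1 + v i)))"

text \<open>The (non-commutative) ring of linear operators on functions of the variables
  \<open>v 0, v 1, \<dots>\<close>, with composition as multiplication.\<close>

typedef lin_op = "{T :: ((nat \<Rightarrow> real) \<Rightarrow> real) \<Rightarrow> ((nat \<Rightarrow> real) \<Rightarrow> real).
    (\<forall>F G. T (\<lambda>v. F v + G v) = (\<lambda>v. T F v + T G v)) \<and>
    (\<forall>c F. T (\<lambda>v. c * F v) = (\<lambda>v. c * T F v))}"
  morphisms app_op Lin_op
  by (rule exI[of _ "\<lambda>F. F"]) auto

setup_lifting type_definition_lin_op

instantiation lin_op :: ring_1
begin

lift_definition zero_lin_op :: lin_op is "\<lambda>F v. 0" by auto
lift_definition one_lin_op :: lin_op is "\<lambda>F. F" by auto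
lift_definition plus_lin_op :: "lin_op \<Rightarrow> lin_op \<Rightarrow> lin_op" is "\<lambda>T U F v. T F v + U F v"
  by (auto simp: algebra_simps)
lift_definition minus_lin_op :: "lin_op \<Rightarrow> lin_op \<Rightarrow> lin_op" is "\<lambda>T U F v. T F v - U F v"
  by (auto simp: algebra_simps)
lift_definition uminus_lin_op :: "lin_op \<Rightarrow> lin_op" is "\<lambda>T F v. - T F v"
  by auto
lift_definition times_lin_op :: "lin_op \<Rightarrow> lin_op \<Rightarrow> lin_op" is "\<lambda>T U F. T (U F)"
  by auto

instance
proof
  show "(0 :: lin_op) \<noteq> 1"
    by transfer (metis zero_neq_one)
  fix a b c :: lin_op
  show "a * b * c = a * (b * c)" by transfer auto
  show "1 * a = a" by transfer auto
  show "a * 1 = a" by transfer auto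
  show "a + b + c = a + (b + c)" by transfer (auto simp: algebra_simps)
  show "a + b = b + a" by transfer (auto simp: algebra_simps)
  show "0 + a = a" by transfer auto
  show "- a + a = 0" by transfer auto
  show "a - b = a + - b" by transfer auto
  show "(a + b) * c = a * c + b * c" by transfer auto
  show "a * (b + c) = a * b + a * c" by transfer auto
qed

end

lift_definition subst_op :: "nat \<Rightarrow> real \<Rightarrow> lin_op" is "\<lambda>i c F v. F (v(i := c))"
  by auto

lemma subst_op_commute:
  "i \<noteq> k \<Longrightarrow> subst_op i a * subst_op k b = subst_op k b * subst_op i a"
  by transfer (simp add: fun_upd_twist)

text \<open>Polynomials in \<open>y\<close> with operator coefficients. The type \<open>poly\<close> has a multiplication only
  over commutative semirings, so they are taken as formal power series, with \<open>y\<close> being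
  \<^const>\<open>fps_X\<close>. The factors commute by \<open>subst_op_commute\<close>, so the order in the
  product does not matter.\<close>

definition op_product :: "nat \<Rightarrow> nat \<Rightarrow> (nat \<Rightarrow> real) \<Rightarrow> lin_op fps" where
  "op_product r h p = prod_list (map
     (\<lambda>i. fps_X * fps_const (subst_op i (gamma (p i)))
        + (1 - fps_X) * fps_const (subst_op i (alpha h (p i)))) [1..<Suc r])"

end

theory Submission
  imports Defs
begin

text \<open>The expected value is the sum over \<open>n\<close> of the probability that the set \<open>R\<close> of letters with
  an \<open>h\<close>-run in the first \<open>n\<close> letters has fewer than \<open>j\<close> elements. Summing
  \<open>y ^ card T * (1 - y) ^ (r - card T)\<close> over all \<open>T \<supseteq> R\<close> gives \<open>y ^ card R\<close>, so this probability is
  a linear combination of the probabilities of \<open>R \<subseteq> T\<close>, with the coefficients of the operator product.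

  Smirnov words are avoided: the value of \<open>S\<close> at \<open>\<gamma>\<close> on \<open>T\<close> and \<open>\<alpha>\<close> off \<open>T\<close> is shown directly to
  be the expected waiting time for the first run of a letter outside \<open>T\<close>. Let \<open>a n\<close> be the probability
  that there is none up to time \<open>n\<close>, and \<open>b i m\<close> the probability that the first one is completed at
  time \<open>m\<close>, by letter \<open>i\<close>. Then \<open>a n * p i ^ h = (\<Sum>k=1..h. p i ^ (h - k) * b i (n + k))\<close>; sum this over \<open>n\<close>
  and use that the \<open>b i m\<close> add up to 1.\<close>

section \<open>Runs in finite words\<close>

lemma has_run_snoc:
  assumes "h \<ge> 1"
  shows "has_run h l (w @ [x]) \<longleftrightarrow> has_run h l w \<or> suffix (replicate h l) (w @ [x])"
  using assms unfolding has_run_def by (subst sublist_snoc) auto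

lemma has_run_appendI: "has_run h l w \<Longrightarrow> has_run h l (w @ u)"
  unfolding has_run_def by (simp add: sublist_appendI sublist_append)

lemma suffix_replicate_imp_last:
  assumes "suffix (replicate h l) w" "h \<ge> 1"
  shows "last w = l"
  using assms by (auto simp: suffix_def)

definition run_free :: "nat \<Rightarrow> 'a set \<Rightarrow> 'a list \<Rightarrow> bool" where
  "run_free h U w \<longleftrightarrow> (\<forall>l\<in>U. \<not> has_run h l w)"

lemma run_free_prefix: "run_free h U (w @ u) \<Longrightarrow> run_free h U w"
  unfolding run_free_def using has_run_appendI by fast

text \<open>A run created by the last letter is a suffix, and since \<open>h \<ge> 1\<close> it then
  consists of that letter; so only \<open>x\<close> itself has to be tested.\<close>

lemma run_free_snoc:
  assumes "h \<ge> 1"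
  shows "run_free h U (w @ [x]) \<longleftrightarrow>
    run_free h U w \<and> \<not> (x \<in> U \<and> suffix (replicate h x) (w @ [x]))"
  using suffix_replicate_imp_last[OF _ assms, of _ "w @ [x]"]
  unfolding run_free_def has_run_snoc[OF assms] last_snoc by blast

text \<open>All \<open>h\<close> copies of \<open>i\<close> certainly contain a run, so there is a
  least number of copies at which the word stops being run-free. The two conditions on
  \<open>k\<close> pin down exactly this number.\<close>

lemma ex1_first_run:
  assumes "h \<ge> 1" "i \<in> U" "run_free h U w"
  shows "\<exists>!k. k \<in> {1..h} \<and> run_free h U (w @ replicate (k - 1) i) \<and>
    suffix (replicate h i) (w @ replicate k i)"
proof -
  let ?P = "\<lambda>k. \<not> run_free h U (w @ replicate k i)"
  have Ph: "?P h"
    using assms unfolding run_free_def has_run_def by auto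
  define k where "k = (LEAST k. ?P k)"
  have Pk: "?P k" unfolding k_def by (rule LeastI, rule Ph)
  have kh: "k \<le> h" unfolding k_def by (rule Least_le, rule Ph)
  have k0: "k \<noteq> 0" using Pk assms(3) by (cases k) auto
  have less: "run_free h U (w @ replicate m i)" if "m < k" for m
    using not_less_Least[of m ?P] that unfolding k_def by blast
  have snoc: "w @ replicate (Suc m) i = (w @ replicate m i) @ [i]" for m
    by (simp add: replicate_append_same)
  \<comment> \<open>One copy fewer is still run-free, so the run is created by the last letter,
    which is \<open>i\<close>.\<close>
  have "suffix (replicate h i) (w @ replicate k i)"
    using Pk less[of "k - 1"] k0 run_free_snoc[OF assms(1), of U "w @ replicate (k-1) i" i] snoc[of "k - 1"]
    by simp
  moreover have "m = k" if m: "m \<in> {1..h}" "run_free h U (w @ replicate (m - 1) i)"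
    "suffix (replicate h i) (w @ replicate m i)" for m
  proof (rule antisym)
    show "k \<le> m" unfolding k_def
      using m(3) assms(2) by (intro Least_le) (auto simp: run_free_def has_run_def)
    show "m \<le> k"
    proof (rule ccontr)
      assume "\<not> m \<le> k"
      then have "k \<le> m - 1" by simp
      then obtain d where "m - 1 = k + d" using le_Suc_ex by blast
      then have "run_free h U (w @ replicate k i)"
        using m(2) run_free_prefix[of h U "w @ replicate k i" "replicate d i"] by (simp add: replicate_add)
      then show False using Pk by blast
    qed
  qed
  ultimately show ?thesis
    using kh k0 less[of "k - 1"] by (intro ex1I[of _ k]) auto
qed

section \<open>Weights of words and the wait for the first run\<close>

locale weighted_words =
  fixes A :: "'a set" and p :: "'a \<Rightarrow> real" and h :: nat
  assumes finite_A: "finite A"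
    and p_pos: "\<And>i. i \<in> A \<Longrightarrow> p i > 0"
    and sum_p: "sum p A = 1"
    and h_pos: "h \<ge> 1"
begin

definition words :: "nat \<Rightarrow> 'a list set" where
  "words n = {w. set w \<subseteq> A \<and> length w = n}"

definition weight :: "'a list \<Rightarrow> real" where
  "weight w = prod_list (map p w)"

definition free_words :: "'a set \<Rightarrow> nat \<Rightarrow> 'a list set" where
  "free_words U n = {w \<in> words n. run_free h U w}"

definition first_runs :: "'a set \<Rightarrow> 'a \<Rightarrow> nat \<Rightarrow> 'a list set" where
  "first_runs U i n =
     {w \<in> words n. w \<noteq> [] \<and> run_free h U (butlast w) \<and> suffix (replicate h i) w}"

text \<open>With \<open>U\<close> the set of letters outside \<open>T\<close>,
  \<open>free_weight U n\<close> and \<open>first_weight U i m\<close> are the \<open>a n\<close>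
  and \<open>b i m\<close> of the introduction.\<close>

definition free_weight :: "'a set \<Rightarrow> nat \<Rightarrow> real" where
  "free_weight U n = sum weight (free_words U n)"

definition first_weight :: "'a set \<Rightarrow> 'a \<Rightarrow> nat \<Rightarrow> real" where
  "first_weight U i n = sum weight (first_runs U i n)"

lemma finite_words [simp]: "finite (words n)"
  unfolding words_def using finite_lists_length_eq[OF finite_A] .

lemma finite_free_words [simp]: "finite (free_words U n)"
  unfolding free_words_def by simp

lemma finite_first_runs [simp]: "finite (first_runs U i n)"
  unfolding first_runs_def by simp

lemma weight_nonneg: "w \<in> words n \<Longrightarrow> weight w \<ge> 0"
  unfolding weight_def words_def
  using p_pos by (fastforce intro!: prod_list_nonneg intro: less_imp_le)

lemma free_weight_nonneg: "free_weight U n \<ge> 0"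
  unfolding free_weight_def free_words_def by (auto intro!: sum_nonneg weight_nonneg)

lemma first_weight_nonneg: "first_weight U i n \<ge> 0"
  unfolding first_weight_def first_runs_def by (auto intro!: sum_nonneg weight_nonneg)

lemma free_weight_0: "free_weight U 0 = 1"
proof -
  have "free_words U 0 = {[]}"
    using h_pos by (auto simp: free_words_def words_def run_free_def has_run_def)
  then show ?thesis by (simp add: free_weight_def weight_def)
qed

lemma first_weight_eq_0:
  assumes "m < h"
  shows "first_weight U i m = 0"
proof -
  have "first_runs U i m = {}"
    using assms by (auto simp: first_runs_def words_def dest!: suffix_length_le)
  then show ?thesis by (simp add: first_weight_def)
qed

text \<open>Appending a random letter preserves total weight because \<open>p\<close> sums to 1. The
  extended word is still run-free or completes a first run, of just one letter.\<close>

lemma free_weight_step: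
  assumes "U \<subseteq> A"
  shows "free_weight U n - free_weight U (Suc n) = (\<Sum>i\<in>U. first_weight U i (Suc n))"
proof -
  define E where "E = {w \<in> words (Suc n). run_free h U (butlast w)}"
  have finU: "finite U" using assms finite_A by (rule finite_subset)
  have "free_weight U n = (\<Sum>w\<in>free_words U n. \<Sum>x\<in>A. weight w * p x)"
    unfolding free_weight_def by (simp add: sum_distrib_left[symmetric] sum_p)
  also have "\<dots> = (\<Sum>(w,x)\<in>free_words U n \<times> A. weight w * p x)"
    by (simp add: sum.cartesian_product)
  also have "\<dots> = sum weight E"
    by (rule sum.reindex_bij_witness[where j = "\<lambda>(w,x). w @ [x]" and i = "\<lambda>w. (butlast w, last w)"])
       (auto simp: E_def free_words_def words_def weight_def append_butlast_last_id
          simp flip: length_greater_0_conv dest: in_set_butlastD last_in_set)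
  also have "E = free_words U (Suc n) \<union> (\<Union>i\<in>U. first_runs U i (Suc n))"
  proof -
    have "run_free h U (butlast w) \<longleftrightarrow> run_free h U w \<or>
        (\<exists>i\<in>U. run_free h U (butlast w) \<and> suffix (replicate h i) w)" if "w \<noteq> []" for w
      using run_free_snoc[OF h_pos, of U "butlast w" "last w"] suffix_replicate_imp_last[OF _ h_pos, of _ w] that
      unfolding append_butlast_last_id[OF that] by blast
    moreover have "w \<noteq> []" if "w \<in> words (Suc n)" for w using that by (auto simp: words_def)
    ultimately show ?thesis
      unfolding E_def free_words_def first_runs_def by blast
  qed
  also have "sum weight \<dots> = free_weight U (Suc n) + sum weight (\<Union>i\<in>U. first_runs U i (Suc n))"
    unfolding free_weight_def
    by (rule sum.union_disjoint)
       (use finU in \<open>auto simp: free_words_def first_runs_def run_free_def has_run_def\<close>)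
  also have "sum weight (\<Union>i\<in>U. first_runs U i (Suc n)) = (\<Sum>i\<in>U. first_weight U i (Suc n))"
    unfolding first_weight_def
  proof (rule sum.UNION_disjoint)
    \<comment> \<open>The completing letter can be read off as the last one, so these sets are
      disjoint.\<close>
    have "last w = i" if "w \<in> first_runs U i (Suc n)" for w i
      using suffix_replicate_imp_last[OF _ h_pos] that by (auto simp: first_runs_def)
    then show "\<forall>i\<in>U. \<forall>j\<in>U. i \<noteq> j \<longrightarrow> first_runs U i (Suc n) \<inter> first_runs U j (Suc n) = {}"
      by blast
  qed (use finU in auto)
  finally show ?thesis by simp
qed

text \<open>Appending \<open>h\<close> copies of \<open>i\<close> to a run-free word completes a first run, necessarily of
  letter \<open>i\<close>, after \<open>k\<close> of these copies for exactly one \<open>k\<close>.\<close>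

lemma free_weight_times_power:
  assumes "i \<in> U" "U \<subseteq> A"
  shows "free_weight U n * p i ^ h = (\<Sum>k=1..h. p i ^ (h - k) * first_weight U i (n + k))"
proof -
  have mem: "w @ replicate k i \<in> first_runs U i (n + k) \<longleftrightarrow>
      w \<in> words n \<and> run_free h U (w @ replicate (k - 1) i) \<and> suffix (replicate h i) (w @ replicate k i)"
    if "k \<ge> 1" "length w = n" for w k
  proof -
    have "replicate k i = replicate (k - 1) i @ [i]"
      using that(1) by (cases k) (simp_all add: replicate_append_same)
    then have "butlast (w @ replicate k i) = w @ replicate (k - 1) i"
      by (metis append.assoc butlast_snoc)
    then show ?thesis
      using that assms by (auto simp: first_runs_def words_def)
  qed
  \<comment> \<open>As \<open>k \<le> h\<close>, the last \<open>k\<close> letters of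
    \<open>u\<close> lie inside its final run of \<open>i\<close>.\<close>
  have dec: "\<exists>w. u = w @ replicate k i \<and> w \<in> words n"
    if "k \<in> {1..h}" "u \<in> first_runs U i (n + k)" for u k
  proof -
    have "suffix (replicate h i) u" "length u = n + k" "set u \<subseteq> A"
      using that by (auto simp: first_runs_def words_def)
    moreover have "suffix (replicate k i) (replicate h i)"
      using that by (auto simp: suffix_def replicate_add[symmetric] intro!: exI[of _ "replicate (h - k) i"])
    ultimately obtain w where "u = w @ replicate k i"
      by (meson suffix_def suffix_order.trans)
    then show ?thesis using \<open>length u = n + k\<close> \<open>set u \<subseteq> A\<close> by (auto simp: words_def)
  qed
  have free: "run_free h U w" if "run_free h U (w @ replicate m i)" for w m
    using that by (rule run_free_prefix)
  \<comment> \<open>The inverse sends \<open>w\<close> to \<open>(k, w @ replicate k i)\<close> with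
    the unique \<open>k\<close> of \<open>ex1_first_run\<close>.\<close>
  have bij: "bij_betw (\<lambda>(k, u). take n u) (SIGMA k:{1..h}. first_runs U i (n + k)) (free_words U n)"
  proof (rule bij_betw_imageI)
    show "inj_on (\<lambda>(k, u). take n u) (SIGMA k:{1..h}. first_runs U i (n + k))"
    proof (rule inj_onI, clarify)
      fix k u k' u'
      assume *: "k \<in> {1..h}" "u \<in> first_runs U i (n + k)"
        "k' \<in> {1..h}" "u' \<in> first_runs U i (n + k')" "take n u = take n u'"
      obtain w w' where w: "u = w @ replicate k i" "w \<in> words n"
          "u' = w' @ replicate k' i" "w' \<in> words n"
        using dec * by metis
      then have ww: "w' = w" using * by (auto simp: words_def)
      have k: "run_free h U (w @ replicate (k - 1) i)" "suffix (replicate h i) (w @ replicate k i)"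
        "run_free h U (w @ replicate (k' - 1) i)" "suffix (replicate h i) (w @ replicate k' i)"
        using * w ww mem[of k w] mem[of k' w] by (auto simp: words_def)
      have "k = k'"
        using ex1_first_run[OF h_pos assms(1) free[OF k(1)]] *(1,3) k by blast
      then show "k = k' \<and> u = u'" using w ww by simp
    qed
    show "(\<lambda>(k, u). take n u) ` (SIGMA k:{1..h}. first_runs U i (n + k)) = free_words U n"
    proof (intro equalityI subsetI)
      fix w assume "w \<in> (\<lambda>(k, u). take n u) ` (SIGMA k:{1..h}. first_runs U i (n + k))"
      then obtain k u where ku: "k \<in> {1..h}" "u \<in> first_runs U i (n + k)" "w = take n u" by auto
      obtain w' where w': "u = w' @ replicate k i" "w' \<in> words n" using dec[OF ku(1,2)] by blast
      then have "w = w'" using ku by (auto simp: words_def)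
      then show "w \<in> free_words U n"
        using ku w' mem[of k w] free by (auto simp: words_def free_words_def)
    next
      fix w assume w: "w \<in> free_words U n"
      then obtain k where "k \<in> {1..h}" "run_free h U (w @ replicate (k - 1) i)"
          "suffix (replicate h i) (w @ replicate k i)"
        using ex1_first_run[OF h_pos assms(1), of w] unfolding free_words_def by blast
      then show "w \<in> (\<lambda>(k, u). take n u) ` (SIGMA k:{1..h}. first_runs U i (n + k))"
        using w mem[of k w] by (intro image_eqI[of _ _ "(k, w @ replicate k i)"])
          (auto simp: free_words_def words_def)
    qed
  qed
  have "free_weight U n * p i ^ h =
      (\<Sum>x\<in>(SIGMA k:{1..h}. first_runs U i (n + k)). weight (case x of (k, u) \<Rightarrow> take n u) * p i ^ h)"
    unfolding free_weight_def sum_distrib_right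
    by (rule sum.reindex_bij_betw[OF bij, symmetric])
  also have "\<dots> = (\<Sum>(k, u)\<in>(SIGMA k:{1..h}. first_runs U i (n + k)). p i ^ (h - k) * weight u)"
  proof (rule sum.cong[OF refl], clarify)
    fix k u assume ku: "k \<in> {1..h}" "u \<in> first_runs U i (n + k)"
    then obtain w where w: "u = w @ replicate k i" "w \<in> words n" using dec by blast
    \<comment> \<open>The \<open>k\<close> appended copies already contribute
      \<open>p i ^ k\<close>; the other \<open>h - k\<close> copies are supplied as a
      factor.\<close>
    then have "p i ^ (h - k) * weight u = weight w * (p i ^ (h - k) * p i ^ k)"
      by (simp add: weight_def prod_list_replicate)
    also have "p i ^ (h - k) * p i ^ k = p i ^ h"
      using ku by (simp flip: power_add)
    finally show "weight (take n u) * p i ^ h = p i ^ (h - k) * weight u"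
      using w by (simp add: words_def)
  qed
  also have "\<dots> = (\<Sum>k=1..h. p i ^ (h - k) * first_weight U i (n + k))"
    unfolding first_weight_def sum_distrib_left by (subst sum.Sigma) auto
  finally show ?thesis .
qed

text \<open>By \<open>free_weight_step\<close> the partial sums are dominated by a telescoping sum
  that starts from 1 and never exceeds it.\<close>

lemma summable_first_weight:
  assumes "i \<in> U" "U \<subseteq> A"
  shows "summable (first_weight U i)"
proof -
  have finU: "finite U" using assms finite_A by (blast intro: finite_subset)
  have "summable (\<lambda>n. first_weight U i (Suc n))"
  proof (rule summableI_nonneg_bounded)
    fix N
    have "(\<Sum>n<N. first_weight U i (Suc n)) \<le> (\<Sum>n<N. \<Sum>i\<in>U. first_weight U i (Suc n))"
      using finU assms first_weight_nonneg by (intro sum_mono member_le_sum) auto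
    also have "\<dots> = (\<Sum>n<N. free_weight U n - free_weight U (Suc n))"
      by (simp add: free_weight_step[OF assms(2)])
    also have "\<dots> \<le> 1"
      using free_weight_nonneg[of U N] by (simp add: sum_lessThan_telescope' free_weight_0)
    finally show "(\<Sum>n<N. first_weight U i (Suc n)) \<le> 1" .
  qed (rule first_weight_nonneg)
  then show ?thesis by (simp add: summable_Suc_iff)
qed

text \<open>No run is complete before time \<open>h\<close>, so the omitted initial terms
  vanish.\<close>

lemma suminf_first_weight_shift:
  assumes "i \<in> U" "U \<subseteq> A" "k \<le> h"
  shows "(\<lambda>n. first_weight U i (n + k)) sums suminf (first_weight U i)"
proof -
  have "(\<Sum>m<k. first_weight U i m) = 0"
    using assms(3) by (intro sum.neutral) (auto simp: first_weight_eq_0)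
  then show ?thesis
    using summable_sums[OF summable_first_weight[OF assms(1,2)]]
    unfolding sums_iff_shift by simp
qed

text \<open>The sum of the tail probabilities \<open>free_weight U n\<close> is the expected wait
  for the first run of a letter in \<open>U\<close>.\<close>

lemma free_weight_sums:
  assumes "U \<subseteq> A" "U \<noteq> {}"
  shows "free_weight U sums (1 / (\<Sum>i\<in>U. p i ^ h / (\<Sum>k<h. p i ^ k)))"
proof -
  have pow: "(\<lambda>n. free_weight U n * p i ^ h) sums
      ((\<Sum>k<h. p i ^ k) * suminf (first_weight U i))" if "i \<in> U" for i
  proof -
    have "(\<Sum>k<h. p i ^ k) = (\<Sum>k=1..h. p i ^ (h - k))"
      by (rule sum.reindex_bij_witness[where i = "\<lambda>k. h - k" and j = "\<lambda>k. h - k"]) auto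
    moreover have "(\<lambda>n. \<Sum>k=1..h. p i ^ (h - k) * first_weight U i (n + k)) sums
        (\<Sum>k=1..h. p i ^ (h - k) * suminf (first_weight U i))"
      using that assms by (intro sums_sum sums_mult suminf_first_weight_shift) auto
    ultimately show ?thesis
      using free_weight_times_power[OF that assms(1)] by (simp add: sum_distrib_right)
  qed
  have pos: "p i ^ h > 0" if "i \<in> U" for i using that assms p_pos by auto
  \<comment> \<open>Convergence is inherited from the identity for a single letter, after cancelling
    \<open>p i ^ h > 0\<close>.\<close>
  have summ: "summable (free_weight U)"
  proof -
    obtain i where i: "i \<in> U" using assms by blast
    have "summable (\<lambda>n. p i ^ h * free_weight U n)"
      using sums_summable[OF pow[OF i]] by (simp only: mult.commute)
    then show ?thesis by (rule summable_mult_D) (rule less_imp_neq[OF pos[OF i], symmetric])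
  qed
  define S where "S = suminf (free_weight U)"
  have first: "suminf (first_weight U i) = S * (p i ^ h / (\<Sum>k<h. p i ^ k))" if "i \<in> U" for i
  proof -
    have "S * p i ^ h = (\<Sum>k<h. p i ^ k) * suminf (first_weight U i)"
      using sums_mult2[OF summable_sums[OF summ], of "p i ^ h"] pow[OF that] sums_unique2
      unfolding S_def by blast
    moreover have "(\<Sum>k<h. p i ^ k) > 0"
      using that assms p_pos h_pos by (intro sum_pos) (auto simp: lessThan_empty_iff)
    ultimately show ?thesis by (simp add: field_simps)
  qed
  \<comment> \<open>Terms of a convergent series tend to 0, so the differences telescope to 1: some
    letter of \<open>U\<close> completes a first run almost surely.\<close>
  have "(\<lambda>n. free_weight U n - free_weight U (Suc n)) sums (free_weight U 0 - 0)"
    using telescope_sums'[OF summable_LIMSEQ_zero[OF summ]] by simp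
  moreover have "(\<lambda>n. free_weight U n - free_weight U (Suc n)) =
      (\<lambda>n. \<Sum>i\<in>U. first_weight U i (n + 1))"
    by (simp add: free_weight_step[OF assms(1)])
  moreover have "(\<lambda>n. \<Sum>i\<in>U. first_weight U i (n + 1)) sums (\<Sum>i\<in>U. suminf (first_weight U i))"
    using assms h_pos by (intro sums_sum suminf_first_weight_shift) auto
  ultimately have "1 = (\<Sum>i\<in>U. suminf (first_weight U i))"
    using sums_unique2 by (fastforce simp: free_weight_0)
  also have "\<dots> = S * (\<Sum>i\<in>U. p i ^ h / (\<Sum>k<h. p i ^ k))"
    by (simp add: first sum_distrib_left)
  \<comment> \<open>The divisor is nonzero since its product with \<open>S\<close> is 1.\<close>
  finally have "S = 1 / (\<Sum>i\<in>U. p i ^ h / (\<Sum>k<h. p i ^ k))"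
    by (metis mult_zero_right nonzero_eq_divide_eq zero_neq_one)
  then show ?thesis using summable_sums[OF summ] S_def by simp
qed

end

section \<open>Inclusion-exclusion and the expansion of the operator product\<close>

lemma sum_Pow_insert:
  fixes f :: "'a set \<Rightarrow> 'b::comm_monoid_add"
  assumes "finite B" "x \<notin> B"
  shows "(\<Sum>T\<in>Pow (insert x B). f T) = (\<Sum>T\<in>Pow B. f T + f (insert x T))"
proof -
  have "inj_on (insert x) (Pow B)" using assms(2) by (auto simp: inj_on_def)
  moreover have "Pow B \<inter> insert x ` Pow B = {}" using assms(2) by auto
  ultimately show ?thesis
    using assms(1) by (simp add: Pow_insert sum.union_disjoint sum.reindex sum.distrib)
qed

text \<open>The coefficient of \<open>y ^ q\<close> when, among \<open>n\<close> factors,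
  \<open>t\<close> contribute \<open>y\<close> (operator \<Gamma>) and the others
  \<open>1 - y\<close> (operator A).\<close>

definition incl_coeff :: "nat \<Rightarrow> nat \<Rightarrow> nat \<Rightarrow> real" where
  "incl_coeff n t q = fps_nth (fps_X ^ t * (1 - fps_X) ^ (n - t)) q"

lemma incl_coeff_eq_0: "q < t \<Longrightarrow> incl_coeff n t q = 0"
  by (simp add: incl_coeff_def fps_X_power_mult_nth)

lemma incl_coeff_Suc_Suc:
  "incl_coeff (Suc n) (Suc t) q = (if q = 0 then 0 else incl_coeff n t (q - 1))"
  by (simp add: incl_coeff_def mult.assoc)

lemma incl_coeff_Suc:
  assumes "t \<le> n"
  shows "incl_coeff (Suc n) t q = incl_coeff n t q - (if q = 0 then 0 else incl_coeff n t (q - 1))"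
proof -
  have eq: "fps_X ^ t * (1 - fps_X) ^ (Suc n - t) =
      fps_X ^ t * (1 - fps_X) ^ (n - t) - fps_X * (fps_X ^ t * (1 - fps_X :: real fps) ^ (n - t))"
    using assms by (simp add: Suc_diff_le algebra_simps)
  show ?thesis
    unfolding incl_coeff_def eq fps_sub_nth fps_X_mult_nth ..
qed

text \<open>Inclusion-exclusion as a product expansion: every factor collapses to \<open>y\<close>
  on \<open>R\<close> and to \<open>y + (1 - y) = 1\<close> off \<open>R\<close>.\<close>

lemma sum_incl_coeff:
  assumes "finite B" "R \<subseteq> B"
  shows "(\<Sum>T\<in>Pow B. incl_coeff (card B) (card T) q * of_bool (R \<subseteq> T)) = of_bool (q = card R)"
proof -
  \<comment> \<open>The value 0 on \<open>R\<close> kills each summand whose \<open>T\<close> misses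
    an element of \<open>R\<close>.\<close>
  define g :: "'a \<Rightarrow> real fps" where "g i = (if i \<in> R then 0 else 1 - fps_X)" for i
  have "(\<Sum>T\<in>Pow B. incl_coeff (card B) (card T) q * of_bool (R \<subseteq> T)) =
      fps_nth (\<Sum>T\<in>Pow B. (\<Prod>i\<in>T. fps_X) * (\<Prod>i\<in>B - T. g i)) q"
    unfolding fps_sum_nth
  proof (rule sum.cong[OF refl])
    fix T assume T: "T \<in> Pow B"
    then have fin: "finite T" "finite (B - T)" "card (B - T) = card B - card T"
      using assms(1) finite_subset[of T B] by (auto simp: card_Diff_subset)
    have "(\<Prod>i\<in>B - T. g i) = (if R \<subseteq> T then (1 - fps_X) ^ (card B - card T) else 0)"
    proof (cases "R \<subseteq> T")
      case True
      then have "(\<Prod>i\<in>B - T. g i) = (\<Prod>i\<in>B - T. 1 - fps_X)"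
        by (intro prod.cong) (auto simp: g_def)
      then show ?thesis using True fin by simp
    next
      case False
      then show ?thesis using assms fin by (auto simp: g_def intro!: prod_zero)
    qed
    then show "incl_coeff (card B) (card T) q * of_bool (R \<subseteq> T) =
        fps_nth ((\<Prod>i\<in>T. fps_X) * (\<Prod>i\<in>B - T. g i)) q"
      by (simp add: incl_coeff_def)
  qed
  also have "(\<Sum>T\<in>Pow B. (\<Prod>i\<in>T. fps_X) * (\<Prod>i\<in>B - T. g i)) = (\<Prod>i\<in>B. fps_X + g i)"
    by (rule prod_add[OF assms(1), symmetric])
  also have "\<dots> = (\<Prod>i\<in>B. if i \<in> R then fps_X else 1)"
    by (intro prod.cong) (auto simp: g_def)
  also have "\<dots> = fps_X ^ card R"
    using assms by (simp add: prod.If_cases Int_absorb1 flip: prod.inter_restrict)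
  finally show ?thesis by simp
qed

lemma app_op_simps:
  "app_op 0 F v = 0" "app_op 1 F = F"
  "app_op (a + b) F v = app_op a F v + app_op b F v"
  "app_op (a - b) F v = app_op a F v - app_op b F v"
  "app_op (a * b) F = app_op a (app_op b F)"
  "app_op (subst_op i c) F v = F (v(i := c))"
  by (transfer, simp)+

lemma app_op_sum: "app_op (sum f B) F v = (\<Sum>x\<in>B. app_op (f x) F v)"
  by (induction B rule: infinite_finite_induct) (simp_all add: app_op_simps)

text \<open>\<open>T\<close> collects the variables at which the \<Gamma> term is chosen. The
  leading factor of a composition updates the point at which the remaining ones are evaluated, so
  the induction generalises over \<open>v\<close>.\<close>

lemma app_op_product:
  assumes "distinct xs"
  shows "app_op (fps_nth (prod_list (map (\<lambda>i. fps_X * fps_const (subst_op i (g i))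
        + (1 - fps_X) * fps_const (subst_op i (a i))) xs)) q) F v =
    (\<Sum>T\<in>Pow (set xs). incl_coeff (length xs) (card T) q *
       F (\<lambda>i. if i \<in> T then g i else if i \<in> set xs then a i else v i))"
  using assms
proof (induction xs arbitrary: q v)
  case Nil
  show ?case by (cases q) (simp_all add: incl_coeff_def app_op_simps)
next
  case (Cons x xs)
  define P where "P = prod_list (map (\<lambda>i. fps_X * fps_const (subst_op i (g i))
        + (1 - fps_X) * fps_const (subst_op i (a i))) xs)"
  define c where "c t q = incl_coeff (length xs) t q" for t q
  \<comment> \<open>Multiplication by \<open>y\<close> shifts coefficients; the case
    \<open>q = 0\<close> guards against truncated subtraction.\<close>
  define c' where "c' t q = (if q = 0 then 0 else c t (q - 1))" for t q
  define G where "G T = F (\<lambda>i. if i \<in> insert x T then g i else if i \<in> set (x # xs) then a i else v i)" for T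
  define H where "H T = F (\<lambda>i. if i \<in> T then g i else if i \<in> set (x # xs) then a i else v i)" for T
  have x: "x \<notin> set xs" and dist: "distinct xs" using Cons.prems by auto
  \<comment> \<open>Here \<open>y s + (1 - y) t = t + y (s - t)\<close>, with operators kept to the
    left of \<open>P\<close>.\<close>
  have nth: "fps_nth ((fps_X * fps_const s + (1 - fps_X) * fps_const t) * P) q =
      t * fps_nth P q + (if q = 0 then 0 else (s - t) * fps_nth P (q - 1))" for s t
    by (simp add: algebra_simps mult.assoc)
  have upd: "(\<lambda>i. if i \<in> T then g i else if i \<in> set xs then a i else (v(x := y)) i) =
      (\<lambda>i. if i \<in> T then g i else if i = x then y else if i \<in> set xs then a i else v i)" for T y
    using x by auto
  have Ha: "F (\<lambda>i. if i \<in> T then g i else if i \<in> set xs then a i else (v(x := a x)) i) = H T"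
    and Hg: "F (\<lambda>i. if i \<in> T then g i else if i \<in> set xs then a i else (v(x := g x)) i) = G T"
    if "T \<subseteq> set xs" for T
    unfolding G_def H_def using that x by (auto intro!: arg_cong[of _ _ F])
  have IHa: "app_op (fps_nth P q) F (v(x := a x)) = (\<Sum>T\<in>Pow (set xs). c (card T) q * H T)" for q
    unfolding P_def Cons.IH[OF dist] c_def using Ha by (intro sum.cong) auto
  have IHg: "app_op (fps_nth P q) F (v(x := g x)) = (\<Sum>T\<in>Pow (set xs). c (card T) q * G T)" for q
    unfolding P_def Cons.IH[OF dist] c_def using Hg by (intro sum.cong) auto
  have "app_op (fps_nth (prod_list (map (\<lambda>i. fps_X * fps_const (subst_op i (g i))
        + (1 - fps_X) * fps_const (subst_op i (a i))) (x # xs))) q) F v =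
      (\<Sum>T\<in>Pow (set xs). c (card T) q * H T) +
      (if q = 0 then 0 else (\<Sum>T\<in>Pow (set xs). c (card T) (q - 1) * G T)
         - (\<Sum>T\<in>Pow (set xs). c (card T) (q - 1) * H T))"
    by (simp add: P_def[symmetric] nth app_op_simps IHa IHg)
  also have "\<dots> = (\<Sum>T\<in>Pow (set xs). (c (card T) q - c' (card T) q) * H T + c' (card T) q * G T)"
    by (simp add: c'_def sum.distrib sum_subtractf algebra_simps)
  also have "\<dots> = (\<Sum>T\<in>Pow (set xs). incl_coeff (Suc (length xs)) (card T) q * H T +
      incl_coeff (Suc (length xs)) (card (insert x T)) q * H (insert x T))"
  proof (rule sum.cong[OF refl])
    fix T assume "T \<in> Pow (set xs)"
    then have T: "T \<subseteq> set xs" "finite T" "x \<notin> T" using x finite_subset by auto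
    moreover have "card T \<le> length xs"
      using T card_mono[of "set xs" T] card_length[of xs] by simp
    ultimately show "(c (card T) q - c' (card T) q) * H T + c' (card T) q * G T =
      incl_coeff (Suc (length xs)) (card T) q * H T +
      incl_coeff (Suc (length xs)) (card (insert x T)) q * H (insert x T)"
      by (simp add: incl_coeff_Suc incl_coeff_Suc_Suc c_def c'_def G_def H_def)
  qed
  also have "\<dots> = (\<Sum>T\<in>Pow (set (x # xs)). incl_coeff (length (x # xs)) (card T) q * H T)"
    by (simp add: sum_Pow_insert[OF finite_set x])
  finally show ?case by (simp only: H_def)
qed

section \<open>The rational function S at the substituted values\<close>

lemma one_plus_alpha:
  assumes "h \<ge> 1"
  shows "1 + alpha h p = (\<Sum>k<h. p ^ k)"
proof (cases "p = 1")
  case False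
  have "p * p ^ (h - 1) = p ^ h" using assms by (cases h) auto
  with False show ?thesis by (simp add: alpha_def geometric_sum field_simps)
\<comment> \<open>At \<open>p = 1\<close> both sides are \<open>h\<close>, thanks to the value of
  \<open>alpha\<close> by continuity.\<close>
qed (simp add: alpha_def)

text \<open>With \<open>G\<close> the geometric sum, the left side is \<open>p - 1 + 1 / G\<close>,
  and \<open>(1 - p) * G = 1 - p ^ h\<close>.\<close>

lemma alpha_ratio:
  assumes "h \<ge> 1" "p > 0"
  shows "p - alpha h p / (1 + alpha h p) = p ^ h / (\<Sum>k<h. p ^ k)"
proof -
  define G where "G = (\<Sum>k<h. p ^ k)"
  have "G > 0" unfolding G_def
    using assms by (intro sum_pos) (auto simp: lessThan_empty_iff)
  moreover have "alpha h p = G - 1" using one_plus_alpha[OF assms(1), of p] G_def by simp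
  moreover have "(1 - p) * G = 1 - p ^ h"
    unfolding G_def by (simp add: one_diff_power_eq)
  ultimately show ?thesis unfolding G_def[symmetric]
    by (simp add: field_simps)
qed

text \<open>As \<open>p\<close> sums to 1, the denominator of S is the sum of
  \<open>p i - v i / (1 + v i)\<close>. Such a term vanishes at \<open>gamma\<close> and is given by
  \<open>alpha_ratio\<close> at \<open>alpha\<close>. The result matches
  \<open>free_weight_sums\<close>.\<close>

lemma smirnov_gf_eq:
  assumes "h \<ge> 1" "\<And>i. i \<in> {1..r} \<Longrightarrow> p i > 0" "(\<Sum>i=1..r. p i) = 1" "T \<subset> {1..r}"
    "\<And>i. i \<in> {1..r} \<Longrightarrow> v i = (if i \<in> T then gamma (p i) else alpha h (p i))"
  shows "smirnov_gf r v = 1 / (\<Sum>i\<in>{1..r} - T. p i ^ h / (\<Sum>k<h. p i ^ k))"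
proof -
  have "p i - v i / (1 + v i) = (if i \<in> {1..r} - T then p i ^ h / (\<Sum>k<h. p i ^ k) else 0)"
    if i: "i \<in> {1..r}" for i
  proof (cases "i \<in> T")
    case True
    \<comment> \<open>A letter outside \<open>T\<close> has positive probability, which forces
      \<open>p i < 1\<close> and keeps \<open>gamma (p i)\<close> a genuine quotient.\<close>
    obtain m where m: "m \<in> {1..r}" "m \<notin> T" using assms(4) by blast
    have "sum p {i, m} \<le> sum p {1..r}"
      using i m assms(2) by (intro sum_mono2) (auto intro: less_imp_le)
    moreover have "i \<noteq> m" using True m by blast
    then have "sum p {i, m} = p i + p m" by simp
    ultimately have "p i < 1" using assms(3) assms(2)[OF m(1)] by linarith
    then have "1 + gamma (p i) = 1 / (1 - p i)" by (simp add: gamma_def field_simps)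
    then show ?thesis using True assms(5)[OF i] \<open>p i < 1\<close> by (simp add: gamma_def)
  next
    case False
    then show ?thesis using alpha_ratio[OF assms(1) assms(2)[OF i]] assms(5)[OF i] i by simp
  qed
  then have "(\<Sum>i=1..r. p i - v i / (1 + v i)) =
      (\<Sum>i=1..r. if i \<in> {1..r} - T then p i ^ h / (\<Sum>k<h. p i ^ k) else 0)"
    by (intro sum.cong) auto
  also have "\<dots> = (\<Sum>i\<in>{1..r} - T. p i ^ h / (\<Sum>k<h. p i ^ k))"
    by (rule sum.mono_neutral_cong_right) auto
  finally show ?thesis
    using assms(3) by (simp add: smirnov_gf_def sum_subtractf)
qed

section \<open>The run time and its tail probabilities\<close>

definition run_letters :: "nat \<Rightarrow> nat \<Rightarrow> nat list \<Rightarrow> nat set" where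
  "run_letters r h w = {l\<in>{1..r}. has_run h l w}"

text \<open>The set of letters with a run only grows with \<open>n\<close>, so the run time exceeds
  \<open>n\<close> exactly if this set is still too small at \<open>n\<close>.\<close>

lemma less_run_time_iff:
  "enat n < run_time r h j x \<longleftrightarrow> card (run_letters r h (map x [1..<Suc n])) < j"
proof -
  let ?R = "\<lambda>n. run_letters r h (map x [1..<Suc n])"
  have ex: "(\<exists>L\<subseteq>{1..r}. card L = j \<and> (\<forall>l\<in>L. has_run h l (map x [1..<Suc n]))) \<longleftrightarrow> j \<le> card (?R n)" for n
  proof
    assume "\<exists>L\<subseteq>{1..r}. card L = j \<and> (\<forall>l\<in>L. has_run h l (map x [1..<Suc n]))"
    then obtain L where "L \<subseteq> {1..r}" "card L = j" "\<forall>l\<in>L. has_run h l (map x [1..<Suc n])" by blast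
    then have "L \<subseteq> ?R n" "card L = j" unfolding run_letters_def by blast+
    then show "j \<le> card (?R n)"
      using card_mono[of "?R n" L] by (simp add: run_letters_def del: upt_Suc)
  next
    assume "j \<le> card (?R n)"
    then obtain L where "L \<subseteq> ?R n" "card L = j" using obtain_subset_with_card_n by metis
    then show "\<exists>L\<subseteq>{1..r}. card L = j \<and> (\<forall>l\<in>L. has_run h l (map x [1..<Suc n]))"
      by (intro exI[of _ L]) (auto simp: run_letters_def simp del: upt_Suc)
  qed
  have mono: "card (?R m) \<le> card (?R n)" if "m \<le> n" for m n
  proof (rule card_mono)
    have eq: "map x [1..<Suc n] = map x [1..<Suc m] @ map x [Suc m..<Suc n]"
      using that upt_add_eq_append[of 1 "Suc m" "n - m"] by (simp flip: map_append)
    show "?R m \<subseteq> ?R n" unfolding run_letters_def eq by (rule Collect_mono) (simp add: has_run_appendI del: upt_Suc)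
  qed (simp add: run_letters_def)
  show ?thesis
  proof
    assume "enat n < run_time r h j x"
    then have "\<not> j \<le> card (?R n)"
      unfolding run_time_def ex by (auto dest: less_INF_D)
    then show "card (?R n) < j" by simp
  next
    assume *: "card (?R n) < j"
    \<comment> \<open>A lower bound on all candidates also covers the case of no candidate, where
      the infimum is infinite.\<close>
    have "enat (Suc n) \<le> run_time r h j x"
      unfolding run_time_def ex
    proof (rule INF_greatest)
      fix m assume "m \<in> {n. j \<le> card (?R n)}"
      then have "\<not> m \<le> n" using * mono[of m n] by auto
      then show "enat (Suc n) \<le> enat m" by simp
    qed
    then show "enat n < run_time r h j x" by (meson Suc_ile_eq)
  qed
qed

text \<open>Finite values are Boolean combinations of finitely many tail events, infinity is a
  countable intersection of them, and \<open>enat\<close> is countable.\<close>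

lemma measurable_enat_tails:
  assumes "\<And>n. {\<omega> \<in> space M. enat n < f \<omega>} \<in> sets M"
  shows "f \<in> measurable M (count_space UNIV)"
proof -
  have "f -` {N} \<inter> space M \<in> sets M" for N
  proof (cases N)
    case (enat m)
    have "x = enat m \<longleftrightarrow> (\<forall>n<m. enat n < x) \<and> \<not> enat m < x" for x
      by (cases x) (auto simp: not_less intro: le_antisym leI)
    then have "f -` {N} \<inter> space M =
        space M - {\<omega> \<in> space M. enat m < f \<omega>} - (\<Union>n<m. space M - {\<omega> \<in> space M. enat n < f \<omega>})"
      unfolding enat by auto
    moreover have "(\<Union>n<m. space M - {\<omega> \<in> space M. enat n < f \<omega>}) \<in> sets M"
      using assms by (intro sets.finite_UN) auto
    ultimately show ?thesis using assms by (simp only: sets.Diff sets.top)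
  next
    case infinity
    have "x = \<infinity> \<longleftrightarrow> (\<forall>n. enat n < x)" for x
      by (cases x) auto
    then have "f -` {N} \<inter> space M = (\<Inter>n. {\<omega> \<in> space M. enat n < f \<omega>})"
      unfolding infinity by auto
    then show ?thesis using assms by auto
  qed
  then show ?thesis
    by (subst measurable_count_space_eq2_countable) auto
qed

text \<open>The integral admits infinite run times; the real value on the right shows that the
  expectation is finite. The point \<open>v\<close> is arbitrary because all variables of S get
  substituted.\<close>

theorem theorem2:
  fixes r h j :: nat and p :: "nat \<Rightarrow> real"
    and M :: "'w measure" and X :: "nat \<Rightarrow> 'w \<Rightarrow> nat"
    and v :: "nat \<Rightarrow> real"
  assumes "r \<ge> 1" and "h \<ge> 1"
    and "\<And>i. i \<in> {1..r} \<Longrightarrow> p i > 0"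
    and "(\<Sum>i=1..r. p i) = 1"
    and "prob_space M"
    and "prob_space.indep_vars M (\<lambda>_. count_space {1..r}) X {1..}"
    and "\<And>k i. k \<ge> 1 \<Longrightarrow> i \<in> {1..r} \<Longrightarrow> measure M {\<omega> \<in> space M. X k \<omega> = i} = p i"
    and "j \<in> {1..r}"
  shows "(\<integral>\<^sup>+\<omega>. ennreal_of_enat (run_time r h j (\<lambda>k. X k \<omega>)) \<partial>M) =
    ennreal (app_op (\<Sum>q=0..j-1. fps_nth (op_product r h p) q) (smirnov_gf r) v)"
proof -
  note [simp del] = One_nat_def upt_Suc
  interpret prob_space M by fact
  interpret weighted_words "{1..r}" p h
    using assms(2-4) by unfold_locales auto
  let ?N = "\<lambda>\<omega>. run_time r h j (\<lambda>k. X k \<omega>)"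
  let ?w = "\<lambda>n \<omega>. map (\<lambda>k. X k \<omega>) [1..<Suc n]"
  \<comment> \<open>The total coefficient with which the choice \<open>T\<close> enters the operator
    sum.\<close>
  define C where "C T = (\<Sum>q<j. incl_coeff r (card T) q)" for T :: "nat set"

  have meas: "X k \<in> measurable M (count_space {1..r})" if "k \<ge> 1" for k
    using assms(6) that by (auto simp: indep_vars_def)
  have range: "X k \<omega> \<in> {1..r}" if "k \<ge> 1" "\<omega> \<in> space M" for k \<omega>
    using measurable_space[OF meas[OF that(1)] that(2)] by simp
  have w_words: "?w n \<omega> \<in> words n" if "\<omega> \<in> space M" for n \<omega>
    using range[OF _ that] by (auto simp: words_def)
  have cyl: "{\<omega> \<in> space M. ?w n \<omega> = u} \<in> events \<and> prob {\<omega> \<in> space M. ?w n \<omega> = u} = weight u"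
    if u: "u \<in> words n" for n u
  proof (cases "n = 0")
    case True
    then show ?thesis using u by (simp add: words_def weight_def prob_space)
  next
    case False
    \<comment> \<open>\<open>X\<close> is indexed from 1 and lists from 0, hence the shift
      \<open>k - 1\<close>.\<close>
    let ?E = "\<lambda>k. X k -` {u ! (k - 1)} \<inter> space M"
    have len: "length u = n" using u by (simp add: words_def)
    have mem: "u ! (k - 1) \<in> {1..r}" if "k \<in> {1..n}" for k
    proof -
      have "u ! (k - 1) \<in> set u" using that len by (intro nth_mem) auto
      then show ?thesis using u by (auto simp: words_def)
    qed
    have "?w n \<omega> = u \<longleftrightarrow> (\<forall>k\<in>{1..n}. X k \<omega> = u ! (k - 1))" for \<omega>
    proof -
      have "?w n \<omega> = u \<longleftrightarrow> (\<forall>m<n. X (Suc m) \<omega> = u ! m)"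
        using len by (auto simp: list_eq_iff_nth_eq plus_1_eq_Suc)
      also have "\<dots> \<longleftrightarrow> (\<forall>k\<in>{1..n}. X k \<omega> = u ! (k - 1))"
      proof (intro iffI ballI allI impI)
        fix k assume *: "\<forall>m<n. X (Suc m) \<omega> = u ! m" "k \<in> {1..n}"
        then show "X k \<omega> = u ! (k - 1)" by (cases k) auto
      next
        fix m assume *: "\<forall>k\<in>{1..n}. X k \<omega> = u ! (k - 1)" "m < n"
        then show "X (Suc m) \<omega> = u ! m" using bspec[OF *(1), of "Suc m"] by simp
      qed
      finally show ?thesis .
    qed
    \<comment> \<open>For \<open>n = 0\<close> this intersection would be \<open>UNIV\<close> and
      not the sample space, hence the case split.\<close>
    then have eq: "{\<omega> \<in> space M. ?w n \<omega> = u} = (\<Inter>k\<in>{1..n}. ?E k)"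
      using False by auto
    have ev: "?E k \<in> events" if "k \<in> {1..n}" for k
      using measurable_sets[OF meas, of k "{u ! (k - 1)}"] mem[OF that] that by auto
    have "prob (\<Inter>k\<in>{1..n}. ?E k) = (\<Prod>k\<in>{1..n}. prob (?E k))"
      by (rule indep_varsD[OF assms(6)]) (use False mem in auto)
    also have "\<dots> = (\<Prod>k\<in>{1..n}. p (u ! (k - 1)))"
    proof (rule prod.cong[OF refl])
      fix k assume k: "k \<in> {1..n}"
      have "?E k = {\<omega> \<in> space M. X k \<omega> = u ! (k - 1)}" by auto
      then show "prob (?E k) = p (u ! (k - 1))" using assms(7) mem[OF k] k by simp
    qed
    also have "\<dots> = (\<Prod>m<n. p (u ! m))"
      by (rule prod.reindex_bij_witness[where i = Suc and j = "\<lambda>k. k - 1"]) auto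
    also have "\<dots> = weight u"
      using len by (simp add: weight_def prod.list_conv_set_nth atLeast0LessThan)
    finally have "prob (\<Inter>k\<in>{1..n}. ?E k) = weight u" .
    moreover have "(\<Inter>k\<in>{1..n}. ?E k) \<in> events"
      by (rule sets.finite_INT) (use ev False in auto)
    ultimately show ?thesis
      unfolding eq by blast
  qed
  \<comment> \<open>An event about the first \<open>n\<close> letters is a finite disjoint union of
    cylinders.\<close>
  have word_event: "{\<omega> \<in> space M. Q (?w n \<omega>)} \<in> events \<and>
      prob {\<omega> \<in> space M. Q (?w n \<omega>)} = (\<Sum>u\<in>words n. weight u * of_bool (Q u))" for n Q
  proof -
    let ?W = "{u \<in> words n. Q u}" and ?E = "\<lambda>u. {\<omega> \<in> space M. ?w n \<omega> = u}"
    have eq: "{\<omega> \<in> space M. Q (?w n \<omega>)} = (\<Union>u\<in>?W. ?E u)"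
      using w_words by blast
    have ev: "?E u \<in> events" and pr: "prob (?E u) = weight u" if "u \<in> words n" for u
      using cyl[OF that] by blast+
    have "prob (\<Union>u\<in>?W. ?E u) = (\<Sum>u\<in>?W. prob (?E u))"
      by (rule finite_measure_finite_Union) (use ev in \<open>auto simp: disjoint_family_on_def\<close>)
    also have "\<dots> = (\<Sum>u\<in>words n. weight u * of_bool (Q u))"
      unfolding sum.inter_filter[OF finite_words] by (rule sum.cong) (simp_all add: pr)
    finally show ?thesis
      unfolding eq using ev by (intro conjI sets.finite_UN) auto
  qed

  \<comment> \<open>As \<open>j \<le> r\<close>, this disposes of \<open>T = {1..r}\<close>, where
    \<open>free_weight {} n\<close> is constantly 1 and the series would diverge.\<close>
  have C_0: "C T = 0" if "card T \<ge> j" for T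
    unfolding C_def using that by (intro sum.neutral) (auto simp: incl_coeff_eq_0)
  have tail: "prob {\<omega> \<in> space M. enat n < ?N \<omega>} =
      (\<Sum>T\<in>Pow {1..r}. C T * free_weight ({1..r} - T) n)" for n
  proof -
    \<comment> \<open>Being run-free outside \<open>T\<close> means that the letters with runs lie
      in \<open>T\<close>; summing \<open>sum_incl_coeff\<close> over \<open>q < j\<close> gives the
      indicator.\<close>
    have ind: "of_bool (card (run_letters r h u) < j) =
        (\<Sum>T\<in>Pow {1..r}. C T * of_bool (run_free h ({1..r} - T) u))" for u
    proof -
      have "(\<Sum>T\<in>Pow {1..r}. C T * of_bool (run_free h ({1..r} - T) u)) =
          (\<Sum>T\<in>Pow {1..r}. \<Sum>q<j. incl_coeff (card {1..r}) (card T) q * of_bool (run_letters r h u \<subseteq> T))"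
        unfolding C_def sum_distrib_right
        by (intro sum.cong refl arg_cong2[where f = "(*)"])
           (auto simp: run_free_def run_letters_def)
      also have "\<dots> = (\<Sum>q<j. of_bool (q = card (run_letters r h u)))"
        by (subst sum.swap, subst sum_incl_coeff) (auto simp: run_letters_def)
      finally show ?thesis by (simp add: of_bool_def)
    qed
    have "prob {\<omega> \<in> space M. enat n < ?N \<omega>} =
        (\<Sum>u\<in>words n. weight u * of_bool (card (run_letters r h u) < j))"
      unfolding less_run_time_iff
      using word_event[of "\<lambda>u. card (run_letters r h u) < j" n] by blast
    also have "\<dots> = (\<Sum>T\<in>Pow {1..r}. \<Sum>u\<in>words n. C T * (weight u * of_bool (run_free h ({1..r} - T) u)))"
      unfolding ind sum_distrib_left by (subst sum.swap) (simp add: mult_ac)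
    also have "\<dots> = (\<Sum>T\<in>Pow {1..r}. C T * free_weight ({1..r} - T) n)"
      unfolding free_weight_def free_words_def sum_distrib_left[symmetric]
      by (simp add: sum.inter_filter of_bool_def if_distrib cong: if_cong)
    finally show ?thesis .
  qed
  have tail_event: "{\<omega> \<in> space M. enat n < ?N \<omega>} \<in> events" for n
    unfolding less_run_time_iff
    using word_event[of "\<lambda>u. card (run_letters r h u) < j" n] by blast

  let ?V = "\<lambda>T i. if i \<in> T then gamma (p i) else if i \<in> {1..r} then alpha h (p i) else v i"
  have sums: "(\<lambda>n. C T * free_weight ({1..r} - T) n) sums (C T * smirnov_gf r (?V T))"
    if T: "T \<in> Pow {1..r}" for T
  proof (cases "T = {1..r}")
    case True
    then show ?thesis using C_0[of T] assms(8) by simp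
  next
    case False
    then have sub: "T \<subset> {1..r}" using T by blast
    have "smirnov_gf r (?V T) = 1 / (\<Sum>i\<in>{1..r} - T. p i ^ h / (\<Sum>k<h. p i ^ k))"
      by (rule smirnov_gf_eq[OF assms(2-4) sub]) simp_all
    moreover have "{1..r} - T \<noteq> {}" using sub by blast
    ultimately have "free_weight ({1..r} - T) sums smirnov_gf r (?V T)"
      using free_weight_sums[OF Diff_subset] by metis
    then show ?thesis by (rule sums_mult)
  qed
  have "app_op (\<Sum>q=0..j-1. fps_nth (op_product r h p) q) (smirnov_gf r) v =
      (\<Sum>q<j. \<Sum>T\<in>Pow {1..r}. incl_coeff r (card T) q * smirnov_gf r (?V T))"
  proof -
    have "{0..j-1} = {..<j}" using assms(8) by auto
    moreover have set: "set [1..<Suc r] = {1..r}" by auto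
    ultimately show ?thesis
      unfolding app_op_sum op_product_def app_op_product[OF distinct_upt] set by simp
  qed
  also have "\<dots> = (\<Sum>T\<in>Pow {1..r}. C T * smirnov_gf r (?V T))"
    by (subst sum.swap) (simp add: C_def sum_distrib_right)
  finally have eq: "app_op (\<Sum>q=0..j-1. fps_nth (op_product r h p) q) (smirnov_gf r) v =
      (\<Sum>T\<in>Pow {1..r}. C T * smirnov_gf r (?V T))" .
  \<comment> \<open>The \<open>C T\<close> may be negative, so the finite sum over \<open>T\<close>
    and the series are exchanged in the reals, before passing to \<open>ennreal\<close>.\<close>
  have rhs: "(\<lambda>n. prob {\<omega> \<in> space M. enat n < ?N \<omega>}) sums
      app_op (\<Sum>q=0..j-1. fps_nth (op_product r h p) q) (smirnov_gf r) v"
    unfolding tail eq using sums by (rule sums_sum)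

  have "?N \<in> measurable M (count_space UNIV)"
    using tail_event by (rule measurable_enat_tails)
  then have "(\<integral>\<^sup>+\<omega>. ennreal_of_enat (?N \<omega>) \<partial>M) = (\<Sum>n. ennreal (prob {\<omega> \<in> space M. enat n < ?N \<omega>}))"
    by (simp add: nn_integral_enat_function emeasure_eq_measure)
  also have "\<dots> = ennreal (app_op (\<Sum>q=0..j-1. fps_nth (op_product r h p) q) (smirnov_gf r) v)"
    by (rule suminf_ennreal_eq[OF _ rhs]) simp
  finally show ?thesis .
qed

end
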